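(* Let $(\Phi^{(j)})_{j=1}^\infty$ be a non-autonomous IFS on a compact metric space $X$ with limit set $J$ and associated nerves $\mathcal N_{j,k}$ ($0\le j<k$). If $\mathcal N_{k,k+1}$ is connected for every $k>0$, then $J$ is locally connected. Moreover, every connected component of $J$ is path-connected. If, in addition, $\mathcal N_{0,1}$ is connected, then $J$ is connected and path-connected.
   Context: Let $X$ be a non-empty compact metric space; $\mathrm{Lip}(f)$ denotes the Lipschitz constant of $f\colon X\to X$. A non-autonomous IFS $(\Phi^{(j)})_{j\ge1}$ on $X$ is a sequence of collections $\Phi^{(j)}=\{f^{(j)}_i\colon X\to X\}_{i\in I^{(j)}}$ of maps, with each index set $I^{(j)}$ finite and non-empty, such that there is a constant $c<1$ with $\mathrm{Lip}(f^{(j)}_i)\le c$ for all $j\ge1$, $i\in I^{(j)}$. Its coding map $\Pi\colon\prod_{j\ge1}I^{(j)}\to X$ is defined by $\{\Pi(i_1,i_2,\dots)\}=\bigcap_{j\ge1}f^{(1)}_{i_1}\circ\cdots\circ f^{(j)}_{i_j}(X)$, and its limit set is $J=\Pi(\prod_{j\ge1}I^{(j)})$. For $j\ge0$, $J_j$ denotes the limit set of the shifted system $(\Phi^{(j+k)})_{k\ge1}$, so $J_0=J$. For $0\le j<k$ and $v=(i_{j+1},\dots,i_k)\in I^{(j+1)}\times\cdots\times I^{(k)}$ put $f_v=f^{(j+1)}_{i_{j+1}}\circ\cdots\circ f^{(k)}_{i_k}$. The nerve $\mathcal N_{j,k}$ is the abstract simplicial complex with vertex set $I^{(j+1)}\times\cdots\times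 I^{(k)}$, in which a set $\{v_0,\dots,v_q\}$ of mutually distinct vertices is a simplex iff $\bigcap_{p=0}^q f_{v_p}(J_k)\ne\emptyset$. A simplicial complex is connected if the equivalence relation on its vertex set generated by $u\sim v$ whenever $\{u,v\}$ is a 1-simplex has exactly one class. *)

theory Defs
  imports "HOL-Analysis.Analysis"
begin

text \<open>
  Level \<open>j \<ge> 1\<close> of a system consists of the maps \<open>f j i\<close> with \<open>i \<in> I j\<close>; the values of
  \<open>I\<close> and \<open>f\<close> at level 0 are never used. Only the restrictions of the maps to \<open>X\<close> matter.
  The Lipschitz constant of a map is at most \<open>c\<close> iff the map is \<open>c\<close>-Lipschitz; the
  requirement \<open>0 \<le> c\<close> contained in \<^const>\<open>lipschitz_on\<close> is no restriction, as
  Lipschitz constants are non-negative.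
\<close>

definition nonautonomous_ifs ::
  "'a::metric_space set \<Rightarrow> (nat \<Rightarrow> 'i set) \<Rightarrow> (nat \<Rightarrow> 'i \<Rightarrow> 'a \<Rightarrow> 'a) \<Rightarrow> bool" where
  "nonautonomous_ifs X I f \<longleftrightarrow>
     (\<forall>j\<ge>1. finite (I j) \<and> I j \<noteq> {}) \<and>
     (\<forall>j\<ge>1. \<forall>i\<in>I j. f j i ` X \<subseteq> X) \<and>
     (\<exists>c<1. \<forall>j\<ge>1. \<forall>i\<in>I j. c-lipschitz_on X (f j i))"

text \<open>\<open>word_map f j k w\<close> is the composition \<open>f (j+1) (w (j+1)) \<circ> \<dots> \<circ> f k (w k)\<close>.\<close>

definition word_map ::
  "(nat \<Rightarrow> 'i \<Rightarrow> 'a \<Rightarrow> 'a) \<Rightarrow> nat \<Rightarrow> nat \<Rightarrow> (nat \<Rightarrow> 'i) \<Rightarrow> 'a \<Rightarrow> 'a" where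
  "word_map f j k w = foldr (\<lambda>l g. f l (w l) \<circ> g) [Suc j..<Suc k] id"

definition coding_map ::
  "'a set \<Rightarrow> (nat \<Rightarrow> 'i \<Rightarrow> 'a \<Rightarrow> 'a) \<Rightarrow> (nat \<Rightarrow> 'i) \<Rightarrow> 'a" where
  "coding_map X f w = the_elem (\<Inter>j\<in>{1..}. word_map f 0 j w ` X)"

definition limit_set ::
  "'a set \<Rightarrow> (nat \<Rightarrow> 'i set) \<Rightarrow> (nat \<Rightarrow> 'i \<Rightarrow> 'a \<Rightarrow> 'a) \<Rightarrow> 'a set" where
  "limit_set X I f = coding_map X f ` (\<Pi>\<^sub>E j\<in>{1..}. I j)"

definition shifted_limit_set ::
  "'a set \<Rightarrow> (nat \<Rightarrow> 'i set) \<Rightarrow> (nat \<Rightarrow> 'i \<Rightarrow> 'a \<Rightarrow> 'a) \<Rightarrow> nat \<Rightarrow> 'a set" where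
  "shifted_limit_set X I f j = limit_set X (\<lambda>k. I (j + k)) (\<lambda>k. f (j + k))"

text \<open>
  Finite words \<open>(i\<^sub>j\<^sub>+\<^sub>1, \<dots>, i\<^sub>k)\<close> are extensional functions on \<open>{j+1..k}\<close>, so that distinct
  words are distinct functions. An abstract simplicial complex is given by its vertex set
  and its set of (non-empty) simplices.
\<close>

definition nerve_vertices :: "(nat \<Rightarrow> 'i set) \<Rightarrow> nat \<Rightarrow> nat \<Rightarrow> (nat \<Rightarrow> 'i) set" where
  "nerve_vertices I j k = (\<Pi>\<^sub>E l\<in>{Suc j..k}. I l)"

definition nerve_simplices ::
  "'a set \<Rightarrow> (nat \<Rightarrow> 'i set) \<Rightarrow> (nat \<Rightarrow> 'i \<Rightarrow> 'a \<Rightarrow> 'a) \<Rightarrow> nat \<Rightarrow> nat \<Rightarrow> (nat \<Rightarrow> 'i) set set" where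
  "nerve_simplices X I f j k =
     {s. finite s \<and> s \<noteq> {} \<and> s \<subseteq> nerve_vertices I j k \<and>
         (\<Inter>v\<in>s. word_map f j k v ` shifted_limit_set X I f k) \<noteq> {}}"

definition complex_connected :: "'v set \<Rightarrow> 'v set set \<Rightarrow> bool" where
  "complex_connected V K \<longleftrightarrow>
     (\<exists>!C. C \<in> V // {(u, v). u \<in> V \<and> v \<in> V \<and> equivclp (\<lambda>x y. x \<noteq> y \<and> {x, y} \<in> K) u v})"

definition nerve_connected ::
  "'a set \<Rightarrow> (nat \<Rightarrow> 'i set) \<Rightarrow> (nat \<Rightarrow> 'i \<Rightarrow> 'a \<Rightarrow> 'a) \<Rightarrow> nat \<Rightarrow> nat \<Rightarrow> bool" where
  "nerve_connected X I f j k \<longleftrightarrow>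
     complex_connected (nerve_vertices I j k) (nerve_simplices X I f j k)"

end

theory Submission imports Defs begin

text \<open>
  Write \<open>L k\<close> for the limit set of the system shifted by \<open>k\<close>. The self-similarity
  \<open>L k = (\<Union>i\<in>I (k+1). f (k+1) i ` L (k+1))\<close> is used throughout, and the \<open>L k\<close> are compact.

  \<^emph>\<open>Path-connectedness.\<close> If the nerve of level \<open>j\<close> to \<open>j+1\<close> is connected, then any two
  points of \<open>L j\<close> are joined by a finite chain of points in which consecutive points lie in a
  common piece \<open>f (j+1) i ` L (j+1)\<close>. Suppose this holds for all \<open>j \<ge> k\<close>. Starting from jump
  functions, a map of the unit interval into \<open>L j\<close> from \<open>a\<close> to \<open>b\<close> is refined by concatenating,
  along the chain from \<open>a\<close> to \<open>b\<close>, the images of the maps already built in \<open>L (j+1)\<close>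
  (\<open>approx\<close>). Each refinement multiplies the size of the discontinuities, and the distance to
  all later refinements, by the contraction ratio; so the maps converge uniformly to a continuous
  path (\<open>near_path_limit\<close>), and \<open>L k\<close> is path-connected.

  \<^emph>\<open>Local connectedness.\<close> By the hypothesis \<open>L k\<close> is path-connected for \<open>k \<ge> 1\<close>, and so for
  every \<open>n \<ge> 1\<close> the limit set is a finite union of compact path-connected sets \<open>f\<^sub>v (L n)\<close> whose
  diameters tend to zero. The pieces that contain a point \<open>x\<close> form a small path-connected
  neighbourhood of \<open>x\<close>, since the finitely many others are closed. Hence the limit set is locally
  path-connected, and its components are its path components.
\<close>

section \<open>Maps of the unit interval with small oscillation\<close>

text \<open>A map \<open>g\<close> of the unit interval into \<open>S\<close> from \<open>a\<close> to \<open>b\<close>, not necessarily continuous, whose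
  values near any time \<open>t\<close> are within \<open>e\<close> of \<open>g t\<close>.\<close>

definition near_path ::
  "real \<Rightarrow> 'a::metric_space set \<Rightarrow> 'a \<Rightarrow> 'a \<Rightarrow> (real \<Rightarrow> 'a) \<Rightarrow> bool" where
  "near_path e S a b g \<longleftrightarrow> g 0 = a \<and> g 1 = b \<and> g ` {0..1} \<subseteq> S \<and>
     (\<forall>t\<in>{0..1}. \<exists>d>0. \<forall>s\<in>{0..1}. dist s t < d \<longrightarrow> dist (g s) (g t) \<le> e)"

lemma near_path_const:
  assumes "a \<in> S" "0 \<le> e"
  shows "near_path e S a a (\<lambda>_. a)"
  using assms by (auto simp: near_path_def intro: exI[of _ 1])

lemma near_path_image:
  assumes g: "near_path e S a b g" and F: "c-lipschitz_on S F" "F ` S \<subseteq> T"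
  shows "near_path (c * e) T (F a) (F b) (F \<circ> g)"
proof -
  have c: "0 \<le> c" using F(1) by (rule lipschitz_on_nonneg)
  have gS: "g t \<in> S" if "t \<in> {0..1}" for t using g that by (auto simp: near_path_def)
  have "\<exists>d>0. \<forall>s\<in>{0..1}. dist s t < d \<longrightarrow> dist (F (g s)) (F (g t)) \<le> c * e"
    if t: "t \<in> {0..1}" for t
  proof -
    obtain d where "d > 0" and d: "\<And>s. s \<in> {0..1} \<Longrightarrow> dist s t < d \<Longrightarrow> dist (g s) (g t) \<le> e"
      using g t unfolding near_path_def by meson
    have "dist (F (g s)) (F (g t)) \<le> c * e" if "s \<in> {0..1}" "dist s t < d" for s
    proof -
      have "dist (F (g s)) (F (g t)) \<le> c * dist (g s) (g t)"
        using F(1) gS that(1) t by (intro lipschitz_onD)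
      also have "\<dots> \<le> c * e" using d[OF that] c by (rule mult_left_mono)
      finally show ?thesis .
    qed
    with \<open>d > 0\<close> show ?thesis by blast
  qed
  then show ?thesis using g F(2) gS by (auto simp: near_path_def)
qed

lemma near_path_join:
  assumes g: "near_path e S a z g" and h: "near_path e S z b h"
  shows "near_path e S a b (g +++ h)"
proof -
  have gt: "\<exists>d>0. \<forall>s\<in>{0..1}. dist s t < d \<longrightarrow> dist (g s) (g t) \<le> e" if "t \<in> {0..1}" for t
    using g that unfolding near_path_def by blast
  have ht: "\<exists>d>0. \<forall>s\<in>{0..1}. dist s t < d \<longrightarrow> dist (h s) (h t) \<le> e" if "t \<in> {0..1}" for t
    using h that unfolding near_path_def by blast
  have ends: "g 0 = a" "g 1 = z" "h 0 = z" "h 1 = b"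
    and "g ` {0..1} \<subseteq> S" "h ` {0..1} \<subseteq> S" using g h by (auto simp: near_path_def)
  have "\<exists>d>0. \<forall>s\<in>{0..1}. dist s t < d \<longrightarrow> dist ((g +++ h) s) ((g +++ h) t) \<le> e"
    if t: "t \<in> {0..1}" for t
  proof -
    consider "t < 1/2" | "t > 1/2" | "t = 1/2" by linarith
    then show ?thesis
    proof cases
      case 1
      obtain d where "d > 0"
        and d: "\<And>s. s \<in> {0..1} \<Longrightarrow> dist s (2 * t) < d \<Longrightarrow> dist (g s) (g (2 * t)) \<le> e"
        using gt[of "2 * t"] 1 t by auto
      have "dist ((g +++ h) s) ((g +++ h) t) \<le> e"
        if "s \<in> {0..1}" "dist s t < min (d/2) (1/2 - t)" for s
        using d[of "2 * s"] 1 that by (auto simp: joinpaths_def dist_real_def abs_if split: if_splits)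
      then show ?thesis using \<open>d > 0\<close> 1 by (intro exI[of _ "min (d/2) (1/2 - t)"]) auto
    next
      case 2
      obtain d where "d > 0"
        and d: "\<And>s. s \<in> {0..1} \<Longrightarrow> dist s (2 * t - 1) < d \<Longrightarrow> dist (h s) (h (2 * t - 1)) \<le> e"
        using ht[of "2 * t - 1"] 2 t by auto
      have "dist ((g +++ h) s) ((g +++ h) t) \<le> e"
        if "s \<in> {0..1}" "dist s t < min (d/2) (t - 1/2)" for s
        using d[of "2 * s - 1"] 2 that by (auto simp: joinpaths_def dist_real_def abs_if split: if_splits)
      then show ?thesis using \<open>d > 0\<close> 2 by (intro exI[of _ "min (d/2) (t - 1/2)"]) auto
    next
      case 3
      obtain d1 where "d1 > 0"
        and d1: "\<And>s. s \<in> {0..1} \<Longrightarrow> dist s 1 < d1 \<Longrightarrow> dist (g s) z \<le> e"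
        using gt[of 1] ends by auto
      obtain d2 where "d2 > 0"
        and d2: "\<And>s. s \<in> {0..1} \<Longrightarrow> dist s 0 < d2 \<Longrightarrow> dist (h s) z \<le> e"
        using ht[of 0] ends by auto
      have z: "(g +++ h) t = z" using ends by (simp add: 3 joinpaths_def)
      have "dist ((g +++ h) s) ((g +++ h) t) \<le> e"
        if "s \<in> {0..1}" "dist s t < min (d1/2) (d2/2)" for s
        unfolding z using d1[of "2 * s"] d2[of "2 * s - 1"] 3 that
        by (auto simp: joinpaths_def dist_real_def abs_if split: if_splits)
      then show ?thesis using \<open>d1 > 0\<close> \<open>d2 > 0\<close>
        by (intro exI[of _ "min (d1/2) (d2/2)"]) auto
    qed
  qed
  moreover have "(g +++ h) ` {0..1} \<subseteq> S"
    using \<open>g ` {0..1} \<subseteq> S\<close> \<open>h ` {0..1} \<subseteq> S\<close> by (force simp: joinpaths_def)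
  ultimately show ?thesis using ends by (auto simp: near_path_def joinpaths_def)
qed

lemma near_path_limit:
  fixes g :: "nat \<Rightarrow> real \<Rightarrow> 'a::metric_space"
  assumes S: "compact S" and near: "\<And>m. near_path (e m) S a b (g m)"
    and close: "\<And>m n t. t \<in> {0..1} \<Longrightarrow> dist (g m t) (g (m + n) t) \<le> e m"
    and e: "e \<longlonglongrightarrow> 0"
  shows "\<exists>p. path p \<and> path_image p \<subseteq> S \<and> pathstart p = a \<and> pathfinish p = b"
proof -
  have gS: "g m t \<in> S" if "t \<in> {0..1}" for m t
    using near[of m] that by (auto simp: near_path_def)
  have small: "\<exists>m. e m < r" if "r > 0" for r
    using order_tendstoD(2)[OF e that] by (auto simp: eventually_sequentially)
  have "\<exists>l\<in>S. (\<lambda>m. g m t) \<longlonglongrightarrow> l" if t: "t \<in> {0..1}" for t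
  proof -
    have "Cauchy (\<lambda>m. g m t)"
    proof (rule metric_CauchyI)
      fix r :: real assume "r > 0"
      then obtain M where M: "e M < r/2" using small[of "r/2"] by auto
      have "dist (g m t) (g n t) < r" if "m \<ge> M" "n \<ge> M" for m n
        using close[OF t, of M "m - M"] close[OF t, of M "n - M"] that M
          dist_triangle3[of "g m t" "g n t" "g M t"] by simp
      then show "\<exists>M. \<forall>m\<ge>M. \<forall>n\<ge>M. dist (g m t) (g n t) < r" by blast
    qed
    then show ?thesis
      using compact_imp_complete[OF S] gS[OF t] unfolding complete_def by simp
  qed
  then obtain h where hS: "\<And>t. t \<in> {0..1} \<Longrightarrow> h t \<in> S"
    and lim: "\<And>t. t \<in> {0..1} \<Longrightarrow> (\<lambda>m. g m t) \<longlonglongrightarrow> h t" by metis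
  have gh: "dist (g m t) (h t) \<le> e m" if t: "t \<in> {0..1}" for m t
  proof (rule LIMSEQ_le_const2)
    show "(\<lambda>n. dist (g m t) (g (n + m) t)) \<longlonglongrightarrow> dist (g m t) (h t)"
      by (intro tendsto_intros LIMSEQ_ignore_initial_segment lim t)
    show "\<exists>N. \<forall>n\<ge>N. dist (g m t) (g (n + m) t) \<le> e m"
      using close[OF t, of m] by (simp add: add.commute)
  qed
  have "continuous_on {0..1} h"
    unfolding continuous_on_iff
  proof (intro ballI allI impI)
    fix t r :: real assume t: "t \<in> {0..1}" and "r > 0"
    then obtain m where m: "e m < r/3" using small[of "r/3"] by auto
    obtain d where "d > 0" and d: "\<And>s. s \<in> {0..1} \<Longrightarrow> dist s t < d \<Longrightarrow> dist (g m s) (g m t) \<le> e m"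
      using near[of m] t unfolding near_path_def by meson
    have "dist (h s) (h t) < r" if s: "s \<in> {0..1}" "dist s t < d" for s
      using d[OF s] gh[OF t, of m] gh[OF s(1), of m] m
        dist_triangle3[of "h s" "g m t" "g m s"] dist_triangle[of "h s" "h t" "g m t"]
      by linarith
    with \<open>d > 0\<close> show "\<exists>d>0. \<forall>s\<in>{0..1}. dist s t < d \<longrightarrow> dist (h s) (h t) < r" by blast
  qed
  moreover have "h 0 = a"
    using lim[of 0] near by (simp add: near_path_def LIMSEQ_const_iff)
  moreover have "h 1 = b"
    using lim[of 1] near by (simp add: near_path_def LIMSEQ_const_iff)
  ultimately show ?thesis using hS
    by (intro exI[of _ h]) (auto simp: path_def path_image_def pathstart_def pathfinish_def)
qed

section \<open>Chains of pieces\<close>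

text \<open>\<open>linked N F S a [(i\<^sub>1, u\<^sub>1, v\<^sub>1), \<dots>, (i\<^sub>m, u\<^sub>m, v\<^sub>m)] b\<close>: going from \<open>F i\<^sub>l u\<^sub>l\<close> to \<open>F i\<^sub>l v\<^sub>l\<close>
  within \<open>F i\<^sub>l ` S\<close>, for \<open>l = 1, \<dots>, m\<close> in turn, leads from \<open>a\<close> to \<open>b\<close>.\<close>

fun linked ::
  "'i set \<Rightarrow> ('i \<Rightarrow> 'a \<Rightarrow> 'a) \<Rightarrow> 'a set \<Rightarrow> 'a \<Rightarrow> ('i \<times> 'a \<times> 'a) list \<Rightarrow> 'a \<Rightarrow> bool" where
  "linked N F S a [] b \<longleftrightarrow> a = b"
| "linked N F S a ((i, u, v) # xs) b \<longleftrightarrow>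
     i \<in> N \<and> u \<in> S \<and> v \<in> S \<and> a = F i u \<and> linked N F S (F i v) xs b"

text \<open>Concatenation along such a chain of the images \<open>F i \<circ> Q u v\<close> of given maps \<open>Q u v\<close> from \<open>u\<close> to
  \<open>v\<close>. It ends with a constant stretch at \<open>b\<close>, which comes from the empty chain.\<close>

fun link_path ::
  "('i \<Rightarrow> 'a \<Rightarrow> 'a) \<Rightarrow> ('a \<Rightarrow> 'a \<Rightarrow> real \<Rightarrow> 'a) \<Rightarrow> 'a::topological_space \<Rightarrow>
     ('i \<times> 'a \<times> 'a) list \<Rightarrow> real \<Rightarrow> 'a" where
  "link_path F Q b [] = (\<lambda>_. b)"
| "link_path F Q b ((i, u, v) # xs) = (F i \<circ> Q u v) +++ link_path F Q b xs"

lemma near_path_link_path: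
  assumes Q: "\<And>u v. u \<in> S \<Longrightarrow> v \<in> S \<Longrightarrow> near_path e S u v (Q u v)"
    and F: "\<And>i. i \<in> N \<Longrightarrow> c-lipschitz_on S (F i)" "\<And>i. i \<in> N \<Longrightarrow> F i ` S \<subseteq> T"
    and "0 \<le> c * e" "b \<in> T" "linked N F S a xs b"
  shows "near_path (c * e) T a b (link_path F Q b xs)"
  using \<open>linked N F S a xs b\<close>
proof (induction xs arbitrary: a)
  case Nil
  then show ?case using assms by (auto intro: near_path_const)
next
  case (Cons x xs)
  obtain i u v where x: "x = (i, u, v)" by (cases x)
  show ?case
    using Cons near_path_join[OF near_path_image[OF Q F] Cons.IH]
    unfolding x by auto
qed

text \<open>Two concatenations along the same chain use the same parametrization, so they are compared
  time by time.\<close>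

lemma dist_link_path:
  assumes Q: "\<And>u v t. u \<in> S \<Longrightarrow> v \<in> S \<Longrightarrow> t \<in> {0..1} \<Longrightarrow>
      Q u v t \<in> S \<and> Q' u v t \<in> S \<and> dist (Q u v t) (Q' u v t) \<le> e"
    and F: "\<And>i. i \<in> N \<Longrightarrow> c-lipschitz_on S (F i)"
    and ce: "0 \<le> c * e" and "linked N F S a xs b" "t \<in> {0..1}"
  shows "dist (link_path F Q b xs t) (link_path F Q' b xs t) \<le> c * e"
  using \<open>linked N F S a xs b\<close> \<open>t \<in> {0..1}\<close>
proof (induction xs arbitrary: a t)
  case Nil
  then show ?case using ce by simp
next
  case (Cons x xs)
  obtain i u v where x: "x = (i, u, v)" by (cases x)
  have i: "i \<in> N" "u \<in> S" "v \<in> S" "linked N F S (F i v) xs b" using Cons.prems x by auto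
  have "dist (F i (Q u v s)) (F i (Q' u v s)) \<le> c * e" if "s \<in> {0..1}" for s
  proof -
    have "dist (F i (Q u v s)) (F i (Q' u v s)) \<le> c * dist (Q u v s) (Q' u v s)"
      using lipschitz_onD[OF F[OF i(1)]] Q[OF i(2,3) that] by blast
    also have "\<dots> \<le> c * e"
      using lipschitz_on_nonneg[OF F[OF i(1)]] Q[OF i(2,3) that] by (simp add: mult_left_mono)
    finally show ?thesis .
  qed
  moreover have "dist (link_path F Q b xs s) (link_path F Q' b xs s) \<le> c * e" if "s \<in> {0..1}" for s
    using Cons.IH i(4) that by blast
  ultimately show ?case using Cons.prems(2) unfolding x by (auto simp: joinpaths_def)
qed

section \<open>Limit sets of contracting systems\<close>

text \<open>A non-autonomous system with a fixed common contraction ratio \<open>c\<close>.\<close>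

locale contracting_system =
  fixes X :: "'a::metric_space set"
    and I :: "nat \<Rightarrow> 'i set"
    and f :: "nat \<Rightarrow> 'i \<Rightarrow> 'a \<Rightarrow> 'a"
    and c :: real
  assumes compact_X: "compact X" and X_nonempty: "X \<noteq> {}"
    and finite_I: "j \<ge> 1 \<Longrightarrow> finite (I j)"
    and f_X: "j \<ge> 1 \<Longrightarrow> i \<in> I j \<Longrightarrow> x \<in> X \<Longrightarrow> f j i x \<in> X"
    and lipschitz_f: "j \<ge> 1 \<Longrightarrow> i \<in> I j \<Longrightarrow> c-lipschitz_on X (f j i)"
    and c_nonneg: "0 \<le> c" and c_less_1: "c < 1"
begin

lemma contracting_system_shift:
  "contracting_system X (\<lambda>k. I (n + k)) (\<lambda>k. f (n + k)) c"
  using compact_X X_nonempty c_nonneg c_less_1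
  by unfold_locales (auto intro: finite_I f_X lipschitz_f)

end

lemma foldr_comp: "foldr (\<lambda>l g. h l \<circ> g) xs k = foldr (\<lambda>l g. h l \<circ> g) xs id \<circ> k"
  by (induction xs) (auto simp: comp_assoc)

lemma word_map_0 [simp]: "word_map f j j w = id"
  by (simp add: word_map_def)

lemma word_map_Suc: "word_map f 0 (Suc j) w = word_map f 0 j w \<circ> f (Suc j) (w (Suc j))"
proof -
  have "[Suc 0..<Suc (Suc j)] = [Suc 0..<Suc j] @ [Suc j]" by simp
  then show ?thesis
    unfolding word_map_def by (simp only: foldr_append) (subst foldr_comp, simp)
qed

lemma word_map_Suc_shift:
  "word_map f 0 (Suc j) w = f 1 (w 1) \<circ> word_map (\<lambda>k. f (1 + k)) 0 j (\<lambda>k. w (1 + k))"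
proof (induction j)
  case 0
  show ?case by (simp add: word_map_Suc)
next
  case (Suc j)
  have "word_map f 0 (Suc (Suc j)) w = word_map f 0 (Suc j) w \<circ> f (Suc (Suc j)) (w (Suc (Suc j)))"
    by (rule word_map_Suc)
  also have "\<dots> = f 1 (w 1) \<circ> word_map (\<lambda>k. f (1 + k)) 0 (Suc j) (\<lambda>k. w (1 + k))"
    unfolding Suc.IH by (simp add: word_map_Suc comp_assoc)
  finally show ?case .
qed

context contracting_system
begin

lemma word_map_X:
  assumes w: "\<And>j. j \<ge> 1 \<Longrightarrow> w j \<in> I j"
  shows "word_map f 0 j w ` X \<subseteq> X \<and> (c ^ j)-lipschitz_on X (word_map f 0 j w)"
proof (induction j)
  case 0
  show ?case by (auto intro!: lipschitz_onI)
next
  case (Suc j)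
  have wj: "f (Suc j) (w (Suc j)) ` X \<subseteq> X" "c-lipschitz_on X (f (Suc j) (w (Suc j)))"
    by (auto intro!: lipschitz_f w f_X)
  then have "(c ^ j * c)-lipschitz_on X (word_map f 0 j w \<circ> f (Suc j) (w (Suc j)))"
    using Suc by (intro lipschitz_on_compose) (auto intro: lipschitz_on_subset)
  then show ?case using wj Suc by (auto simp: word_map_Suc mult.commute)
qed

lemma dist_X: "x \<in> X \<Longrightarrow> y \<in> X \<Longrightarrow> dist x y \<le> diameter X"
  by (intro diameter_bounded_bound compact_imp_bounded compact_X)

lemma power_c_tendsto: "(\<lambda>n. c ^ n * d) \<longlonglongrightarrow> 0"
  using c_nonneg c_less_1 by (intro tendsto_mult_left_zero LIMSEQ_power_zero) auto

text \<open>The coding map is well defined: the images of \<open>X\<close> are nested compact sets whose diameters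
  tend to zero.\<close>

lemma Inter_word_map:
  assumes w: "\<And>j. j \<ge> 1 \<Longrightarrow> w j \<in> I j"
  shows "(\<Inter>j\<in>{1..}. word_map f 0 j w ` X) = {coding_map X f w}"
proof -
  let ?F = "\<lambda>j. word_map f 0 j w ` X"
  have anti: "?F n \<subseteq> ?F m" if "m \<le> n" for m n
    using that
  proof (induction n rule: dec_induct)
    case (step n)
    have "?F (Suc n) \<subseteq> ?F n"
      using f_X[of "Suc n" "w (Suc n)"] w[of "Suc n"] by (auto simp: word_map_Suc)
    with step show ?case by blast
  qed auto
  have "X \<inter> (\<Inter>j\<in>{1..}. ?F j) \<noteq> {}"
  proof (rule compact_imp_fip_image[OF compact_X])
    show "closed (?F j)" if "j \<in> {1..}" for j
      using word_map_X[OF w, where j = j] lipschitz_on_continuous_on compact_X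
      by (blast intro: compact_imp_closed compact_continuous_image)
    fix K :: "nat set" assume K: "finite K" "K \<subseteq> {1..}"
    have "?F (Max (insert 0 K)) \<subseteq> ?F j" if "j \<in> K" for j
      using K that by (intro anti) simp
    moreover have "?F (Max (insert 0 K)) \<subseteq> X" using word_map_X[OF w] by simp
    moreover have "?F (Max (insert 0 K)) \<noteq> {}" using X_nonempty by simp
    ultimately show "X \<inter> (\<Inter>j\<in>K. ?F j) \<noteq> {}" by blast
  qed
  then obtain x where x: "x \<in> (\<Inter>j\<in>{1..}. ?F j)" by blast
  have "y = x" if y: "y \<in> (\<Inter>j\<in>{1..}. ?F j)" for y
  proof -
    have "dist y x \<le> c ^ n * diameter X" if "n \<ge> 1" for n
    proof -
      have "y \<in> ?F n" "x \<in> ?F n" using x y that by auto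
      then obtain y' x' where y': "y' \<in> X" "y = word_map f 0 n w y'"
        and x': "x' \<in> X" "x = word_map f 0 n w x'" by blast
      then have "dist y x \<le> c ^ n * dist y' x'"
        using word_map_X[OF w, where j = n] by (auto intro: lipschitz_onD)
      also have "\<dots> \<le> c ^ n * diameter X"
        using dist_X[of y' x'] x' y' c_nonneg by (simp add: mult_left_mono)
      finally show ?thesis .
    qed
    then have "dist y x \<le> 0"
      using power_c_tendsto[of "diameter X"] by (intro LIMSEQ_le_const) auto
    then show ?thesis by simp
  qed
  with x have "(\<Inter>j\<in>{1..}. ?F j) = {x}" by blast
  then show ?thesis by (simp add: coding_map_def)
qed

lemma coding_map_in_X:
  assumes w: "\<And>j. j \<ge> 1 \<Longrightarrow> w j \<in> I j"
  shows "coding_map X f w \<in> X"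
proof -
  have "(\<Inter>j\<in>{1..}. word_map f 0 j w ` X) = {coding_map X f w}"
    using w by (rule Inter_word_map)
  then have "coding_map X f w \<in> (\<Inter>j\<in>{1..}. word_map f 0 j w ` X)" by (simp only: singletonI)
  then have "coding_map X f w \<in> word_map f 0 1 w ` X" by (rule INT_D) simp
  then show ?thesis using word_map_X[OF w, where j = 1] by blast
qed

lemma coding_map_eqI:
  assumes w: "\<And>j. j \<ge> 1 \<Longrightarrow> w j \<in> I j" and "\<And>j. j \<ge> 1 \<Longrightarrow> x \<in> word_map f 0 j w ` X"
  shows "coding_map X f w = x"
proof -
  have "x \<in> (\<Inter>j\<in>{1..}. word_map f 0 j w ` X)" using assms(2) by simp
  also have "\<dots> = {coding_map X f w}" using w by (rule Inter_word_map)
  finally show ?thesis by simp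
qed

lemma coding_map_shift:
  assumes w: "\<And>j. j \<ge> 1 \<Longrightarrow> w j \<in> I j"
  shows "coding_map X f w = f 1 (w 1) (coding_map X (\<lambda>k. f (1 + k)) (\<lambda>k. w (1 + k)))"
proof (rule coding_map_eqI[OF w])
  interpret S: contracting_system X "\<lambda>k. I (1 + k)" "\<lambda>k. f (1 + k)" c
    by (rule contracting_system_shift)
  have w': "w (1 + j) \<in> I (1 + j)" for j using w by simp
  let ?z = "coding_map X (\<lambda>k. f (1 + k)) (\<lambda>k. w (1 + k))"
  fix j :: nat assume "j \<ge> 1"
  then obtain m where m: "j = Suc m" using Suc_le_D by auto
  have "?z \<in> word_map (\<lambda>k. f (1 + k)) 0 m (\<lambda>k. w (1 + k)) ` X"
  proof (cases "m = 0")
    case True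
    then show ?thesis using S.coding_map_in_X[of "\<lambda>k. w (1 + k)"] w' by simp
  next
    case False
    have "(\<Inter>j\<in>{1..}. word_map (\<lambda>k. f (1 + k)) 0 j (\<lambda>k. w (1 + k)) ` X) = {?z}"
      using w' by (intro S.Inter_word_map)
    then have "?z \<in> (\<Inter>j\<in>{1..}. word_map (\<lambda>k. f (1 + k)) 0 j (\<lambda>k. w (1 + k)) ` X)"
      by (simp only: singletonI)
    then show ?thesis using False by (elim INT_D) simp
  qed
  then show "f 1 (w 1) ?z \<in> word_map f 0 j w ` X"
    unfolding m word_map_Suc_shift by auto
qed (use w in auto)

text \<open>The points of the limit set are those that can be pulled back through the system for ever.\<close>

lemma limit_set_iff:
  "x \<in> limit_set X I f \<longleftrightarrow>
     (\<exists>s. s 0 = x \<and> (\<forall>n. s n \<in> X \<and> (\<exists>i\<in>I (Suc n). s n = f (Suc n) i (s (Suc n)))))"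
  (is "_ \<longleftrightarrow> ?R")
proof
  assume "x \<in> limit_set X I f"
  then obtain w where w: "\<And>j. j \<ge> 1 \<Longrightarrow> w j \<in> I j" and x: "x = coding_map X f w"
    by (auto simp: limit_set_def)
  define s where "s n = coding_map X (\<lambda>k. f (n + k)) (\<lambda>k. w (n + k))" for n
  have "s n \<in> X \<and> s n = f (Suc n) (w (Suc n)) (s (Suc n))" for n
  proof -
    interpret S: contracting_system X "\<lambda>k. I (n + k)" "\<lambda>k. f (n + k)" c
      by (rule contracting_system_shift)
    show ?thesis
      using S.coding_map_in_X[of "\<lambda>k. w (n + k)"] S.coding_map_shift[of "\<lambda>k. w (n + k)"] w
      by (simp add: s_def)
  qed
  moreover have "s 0 = x" by (simp add: s_def x)
  moreover have "w (Suc n) \<in> I (Suc n)" for n using w by simp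
  ultimately show ?R by blast
next
  assume ?R
  then obtain s where s: "s 0 = x" "\<And>n. s n \<in> X"
    and "\<And>n. \<exists>i\<in>I (Suc n). s n = f (Suc n) i (s (Suc n))" by blast
  then obtain v where v: "\<And>n. v n \<in> I (Suc n)" "\<And>n. s n = f (Suc n) (v n) (s (Suc n))" by metis
  define w where "w = restrict (\<lambda>j. v (j - 1)) {1..}"
  have w: "w j \<in> I j" if "j \<ge> 1" for j using v(1)[of "j - 1"] that by (simp add: w_def)
  have "s 0 = word_map f 0 n w (s n)" for n
    by (induction n) (auto simp: word_map_Suc w_def simp flip: v(2))
  then have "coding_map X f w = x" using s w by (intro coding_map_eqI) auto
  moreover have "w \<in> (\<Pi>\<^sub>E j\<in>{1..}. I j)" using w by (auto simp: w_def)
  ultimately show "x \<in> limit_set X I f" by (auto simp: limit_set_def)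
qed

abbreviation L :: "nat \<Rightarrow> 'a set" where
  "L \<equiv> shifted_limit_set X I f"

lemma L_iff:
  "x \<in> L k \<longleftrightarrow>
     (\<exists>s. s 0 = x \<and> (\<forall>n. s n \<in> X \<and> (\<exists>i\<in>I (Suc (k + n)). s n = f (Suc (k + n)) i (s (Suc n)))))"
  using contracting_system.limit_set_iff[OF contracting_system_shift[of k]]
  by (simp add: shifted_limit_set_def)

lemma L_0: "L 0 = limit_set X I f"
  by (simp add: shifted_limit_set_def)

lemma L_subset_X: "L k \<subseteq> X"
  by (auto simp: L_iff)

text \<open>The \<open>L k\<close> are the largest family of subsets of \<open>X\<close> in which every point has a preimage, by
  a map of the next level, in the next set.\<close>

lemma L_coinduct:
  assumes X: "\<And>n. A n \<subseteq> X"
    and step: "\<And>n. A n \<subseteq> (\<Union>i\<in>I (Suc n). f (Suc n) i ` A (Suc n))"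
  shows "A k \<subseteq> L k"
proof
  fix x assume x: "x \<in> A k"
  have "\<exists>s. \<forall>n. (s n \<in> A (k + n) \<and> (n = 0 \<longrightarrow> s n = x)) \<and>
      (\<exists>i\<in>I (Suc (k + n)). s n = f (Suc (k + n)) i (s (Suc n)))"
  proof (rule dependent_nat_choice)
    show "\<exists>y. y \<in> A (k + 0) \<and> (0 = (0::nat) \<longrightarrow> y = x)" using x by simp
    fix y n assume "y \<in> A (k + n) \<and> (n = 0 \<longrightarrow> y = x)"
    then have "y \<in> (\<Union>i\<in>I (Suc (k + n)). f (Suc (k + n)) i ` A (Suc (k + n)))"
      using step[of "k + n"] by (auto simp only: subsetD)
    then show "\<exists>z. (z \<in> A (k + Suc n) \<and> (Suc n = 0 \<longrightarrow> z = x)) \<and>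
        (\<exists>i\<in>I (Suc (k + n)). y = f (Suc (k + n)) i z)"
      by auto
  qed
  then show "x \<in> L k" using X unfolding L_iff by blast
qed

lemma L_Suc: "L k = (\<Union>i\<in>I (Suc k). f (Suc k) i ` L (Suc k))"
proof
  show "L k \<subseteq> (\<Union>i\<in>I (Suc k). f (Suc k) i ` L (Suc k))"
  proof
    fix x assume "x \<in> L k"
    then obtain s where s: "s 0 = x"
      "\<And>n. s n \<in> X \<and> (\<exists>i\<in>I (Suc (k + n)). s n = f (Suc (k + n)) i (s (Suc n)))"
      unfolding L_iff by blast
    have "s (Suc 0) \<in> L (Suc k)"
      unfolding L_iff using s(2)[of "Suc _"] by (intro exI[of _ "\<lambda>n. s (Suc n)"]) simp
    then show "x \<in> (\<Union>i\<in>I (Suc k). f (Suc k) i ` L (Suc k))" using s(1) s(2)[of 0] by auto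
  qed
  show "(\<Union>i\<in>I (Suc k). f (Suc k) i ` L (Suc k)) \<subseteq> L k"
  proof clarify
    fix i y assume i: "i \<in> I (Suc k)" and y: "y \<in> L (Suc k)"
    then obtain s where s: "s 0 = y"
      "\<And>n. s n \<in> X \<and> (\<exists>i\<in>I (Suc (Suc k + n)). s n = f (Suc (Suc k + n)) i (s (Suc n)))"
      unfolding L_iff by blast
    have "f (Suc k) i y \<in> X" using f_X[of "Suc k"] i L_subset_X y by auto
    then show "f (Suc k) i y \<in> L k"
      unfolding L_iff using s i
      by (intro exI[of _ "case_nat (f (Suc k) i y) s"]) (auto split: nat.split)
  qed
qed

lemma continuous_f: "j \<ge> 1 \<Longrightarrow> i \<in> I j \<Longrightarrow> continuous_on X (f j i)"
  using lipschitz_f lipschitz_on_continuous_on by blast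

text \<open>The closures of the \<open>L k\<close> satisfy the same self-similarity, so they are contained in the
  \<open>L k\<close> by coinduction.\<close>

lemma compact_L: "compact (L k)"
proof -
  have clX: "closure (L n) \<subseteq> X" for n
    using L_subset_X compact_imp_closed[OF compact_X] by (rule closure_minimal)
  have "closure (L n) \<subseteq> (\<Union>i\<in>I (Suc n). f (Suc n) i ` closure (L (Suc n)))" for n
  proof (rule closure_minimal)
    show "L n \<subseteq> (\<Union>i\<in>I (Suc n). f (Suc n) i ` closure (L (Suc n)))"
      using L_Suc[of n] closure_subset[of "L (Suc n)"] by blast
    have "compact (closure (L (Suc n)))"
      using clX compact_X by (metis closed_closure compact_Int_closed inf.absorb_iff2)
    then have "compact (f (Suc n) i ` closure (L (Suc n)))" if "i \<in> I (Suc n)" for i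
      using continuous_on_subset[OF continuous_f clX] that
      by (intro compact_continuous_image) auto
    then show "closed (\<Union>i\<in>I (Suc n). f (Suc n) i ` closure (L (Suc n)))"
      using finite_I[of "Suc n"] by (intro closed_UN compact_imp_closed) auto
  qed
  then have "closure (L k) \<subseteq> L k" using L_coinduct[of "\<lambda>n. closure (L n)"] clX by blast
  then have "closed (L k)" by (metis closure_subset closure_eq subset_antisym)
  then show ?thesis
    using compact_X L_subset_X by (metis compact_Int_closed inf.absorb_iff2)
qed

section \<open>Path-connectedness\<close>

text \<open>An edge of the nerve is a common point of two pieces, where a chain can pass from one to the
  other.\<close>

lemma linked_if_nerve_connected:
  assumes "nerve_connected X I f k (k + 1)" and a: "a \<in> L k" and b: "b \<in> L k"
  shows "\<exists>xs. linked (I (Suc k)) (f (Suc k)) (L (Suc k)) a xs b"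
proof -
  let ?V = "nerve_vertices I k (k + 1)"
  let ?r = "\<lambda>x y. x \<noteq> y \<and> {x, y} \<in> nerve_simplices X I f k (k + 1)"
  let ?R = "{(u, v). u \<in> ?V \<and> v \<in> ?V \<and> equivclp ?r u v}"
  let ?F = "f (Suc k)" and ?S = "L (Suc k)"
  have V: "v \<in> ?V \<Longrightarrow> v (Suc k) \<in> I (Suc k)" for v by (auto simp: nerve_vertices_def)
  have ex_v: "\<exists>v\<in>?V. v (Suc k) = i" if "i \<in> I (Suc k)" for i
    using that by (intro bexI[of _ "restrict (\<lambda>_. i) {Suc k}"]) (auto simp: nerve_vertices_def)
  have wm: "word_map f k (Suc k) v = ?F (v (Suc k))" for v by (simp add: word_map_def)
  have edge: "u \<in> ?V \<and> v \<in> ?V \<and> (\<exists>z. z \<in> ?F (u (Suc k)) ` ?S \<and> z \<in> ?F (v (Suc k)) ` ?S)"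
    if "?r u v \<or> ?r v u" for u v
  proof -
    have "{u, v} \<in> nerve_simplices X I f k (k + 1)" using that by (auto simp: insert_commute)
    then have "{u, v} \<subseteq> ?V" "(\<Inter>x\<in>{u, v}. word_map f k (k + 1) x ` L (k + 1)) \<noteq> {}"
      unfolding nerve_simplices_def by blast+
    moreover from this(2) obtain z where "z \<in> (\<Inter>x\<in>{u, v}. word_map f k (k + 1) x ` L (k + 1))"
      by blast
    then have "z \<in> ?F (u (Suc k)) ` ?S" "z \<in> ?F (v (Suc k)) ` ?S"
      by (simp_all add: wm)
    ultimately show ?thesis by blast
  qed
  have linked_vertices: "\<forall>x \<in> ?F (u (Suc k)) ` ?S. \<exists>xs. linked (I (Suc k)) ?F ?S x xs y"
    if "equivclp ?r u v" and v: "v \<in> ?V" and y: "y \<in> ?F (v (Suc k)) ` ?S" for u v y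
    using that(1)
  proof (induction rule: converse_equivclp_induct)
    case base
    show ?case
    proof
      fix x assume "x \<in> ?F (v (Suc k)) ` ?S"
      then obtain x' y' where "x' \<in> ?S" "x = ?F (v (Suc k)) x'" "y' \<in> ?S" "y = ?F (v (Suc k)) y'"
        using y by blast
      then have "linked (I (Suc k)) ?F ?S x [(v (Suc k), x', y')] y" using V[OF v] by simp
      then show "\<exists>xs. linked (I (Suc k)) ?F ?S x xs y" by blast
    qed
  next
    case (step u w)
    from edge[OF step.hyps(1)] obtain z where u: "u \<in> ?V"
      and z: "z \<in> ?F (u (Suc k)) ` ?S" "z \<in> ?F (w (Suc k)) ` ?S" by blast
    from step.IH z(2) obtain xs where xs: "linked (I (Suc k)) ?F ?S z xs y" by blast
    show ?case
    proof
      fix x assume "x \<in> ?F (u (Suc k)) ` ?S"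
      then obtain x' z' where "x' \<in> ?S" "x = ?F (u (Suc k)) x'" "z' \<in> ?S" "z = ?F (u (Suc k)) z'"
        using z(1) by blast
      then have "linked (I (Suc k)) ?F ?S x ((u (Suc k), x', z') # xs) y" using V[OF u] xs by simp
      then show "\<exists>xs. linked (I (Suc k)) ?F ?S x xs y" by blast
    qed
  qed
  obtain u v where u: "u \<in> ?V" "a \<in> ?F (u (Suc k)) ` ?S" and v: "v \<in> ?V" "b \<in> ?F (v (Suc k)) ` ?S"
    using a b ex_v unfolding L_Suc[of k] by blast
  have "?R `` {u} \<in> ?V // ?R" "?R `` {v} \<in> ?V // ?R" by (rule quotientI, fact u(1), rule quotientI, fact v(1))
  then have "?R `` {u} = ?R `` {v}"
    using assms(1) unfolding nerve_connected_def complex_connected_def by blast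
  moreover have "v \<in> ?R `` {v}" using v by (simp add: equivclp_def)
  ultimately have "equivclp ?r u v" by blast
  then show ?thesis using linked_vertices v u by blast
qed

text \<open>The \<open>m\<close>-th refinement of the jump from \<open>a\<close> to \<open>b\<close> in \<open>L k\<close>, given chains \<open>ch k a b\<close> from \<open>a\<close>
  to \<open>b\<close> of pieces of \<open>L k\<close>.\<close>

primrec approx ::
  "(nat \<Rightarrow> 'a \<Rightarrow> 'a \<Rightarrow> ('i \<times> 'a \<times> 'a) list) \<Rightarrow> nat \<Rightarrow> nat \<Rightarrow> 'a \<Rightarrow> 'a \<Rightarrow> real \<Rightarrow> 'a" where
  "approx ch 0 k a b = (\<lambda>t. if t = 1 then b else a)"
| "approx ch (Suc m) k a b = link_path (f (Suc k)) (approx ch m (Suc k)) b (ch k a b)"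

lemma path_connected_L:
  assumes "\<And>j. j \<ge> k \<Longrightarrow> nerve_connected X I f j (j + 1)"
  shows "path_connected (L k)"
proof -
  have "\<exists>xs. linked (I (Suc j)) (f (Suc j)) (L (Suc j)) a xs b"
    if "j \<ge> k" "a \<in> L j" "b \<in> L j" for j a b
    using linked_if_nerve_connected assms that by blast
  then obtain ch where
    ch: "\<And>j a b. j \<ge> k \<Longrightarrow> a \<in> L j \<Longrightarrow> b \<in> L j \<Longrightarrow>
      linked (I (Suc j)) (f (Suc j)) (L (Suc j)) a (ch j a b) b" by metis
  define D where "D = diameter X"
  have D: "dist x y \<le> D" if "x \<in> L j" "y \<in> L j" for x y j
    using dist_X L_subset_X that unfolding D_def by blast
  have D0: "0 \<le> c ^ m * D" for m
    unfolding D_def using c_nonneg diameter_ge_0[OF compact_imp_bounded[OF compact_X]] by simp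
  have lip: "c-lipschitz_on (L (Suc j)) (f (Suc j) i)" "f (Suc j) i ` L (Suc j) \<subseteq> L j"
    if "i \<in> I (Suc j)" for i j
    using lipschitz_on_subset[OF lipschitz_f L_subset_X] L_Suc[of j] that by auto
  have near: "near_path (c ^ m * D) (L j) a b (approx ch m j a b)"
    if "j \<ge> k" "a \<in> L j" "b \<in> L j" for m j a b
    using that
  proof (induction m arbitrary: j a b)
    case 0
    then show ?case using D[of _ j]
      by (auto simp: near_path_def intro!: exI[of _ 1])
  next
    case (Suc m)
    have "near_path (c * (c ^ m * D)) (L j) a b
        (link_path (f (Suc j)) (approx ch m (Suc j)) b (ch j a b))"
    proof (rule near_path_link_path)
      show "linked (I (Suc j)) (f (Suc j)) (L (Suc j)) a (ch j a b) b" using ch Suc.prems by blast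
      show "0 \<le> c * (c ^ m * D)" using D0[of "Suc m"] by (simp add: mult.assoc)
    qed (use Suc lip in auto)
    then show ?case by (simp add: mult.assoc)
  qed
  have in_L: "approx ch m j a b t \<in> L j"
    if "j \<ge> k" "a \<in> L j" "b \<in> L j" "t \<in> {0..1}" for m j a b t
    using near[OF that(1-3), of m] that(4) by (auto simp: near_path_def)
  have close: "dist (approx ch m j a b t) (approx ch (m + n) j a b t) \<le> c ^ m * D"
    if "j \<ge> k" "a \<in> L j" "b \<in> L j" "t \<in> {0..1}" for m n j a b t
    using that
  proof (induction m arbitrary: j a b t)
    case 0
    then show ?case
      using D[OF in_L[OF 0, of 0] in_L[OF 0, of n]] by simp
  next
    case (Suc m)
    have "dist (link_path (f (Suc j)) (approx ch m (Suc j)) b (ch j a b) t)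
       (link_path (f (Suc j)) (approx ch (m + n) (Suc j)) b (ch j a b) t) \<le> c * (c ^ m * D)"
    proof (rule dist_link_path)
      show "linked (I (Suc j)) (f (Suc j)) (L (Suc j)) a (ch j a b) b" using ch Suc.prems by blast
    qed (use Suc in_L lip D0[of "Suc m"] in \<open>auto simp: mult.assoc\<close>)
    then show ?case by (simp add: mult.assoc)
  qed
  show ?thesis
    unfolding path_connected_def
  proof (intro ballI)
    fix a b assume ab: "a \<in> L k" "b \<in> L k"
    then show "\<exists>g. path g \<and> path_image g \<subseteq> L k \<and> pathstart g = a \<and> pathfinish g = b"
      by (intro near_path_limit[OF compact_L near close power_c_tendsto]) auto
  qed
qed

end

section \<open>Local path-connectedness\<close>

text \<open>A finite cover of \<open>J\<close> by compact path-connected sets of diameter at most \<open>e\<close>. Its existence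
  for all \<open>e > 0\<close> is a variant of Sierpinski's property S.\<close>

definition fine_cover :: "real \<Rightarrow> 'a::metric_space set \<Rightarrow> bool" where
  "fine_cover e J \<longleftrightarrow> (\<exists>\<C>. finite \<C> \<and> \<Union>\<C> = J \<and>
     (\<forall>C\<in>\<C>. compact C \<and> path_connected C \<and> (\<forall>x\<in>C. \<forall>y\<in>C. dist x y \<le> e)))"

lemma locally_path_connected_if_fine_cover:
  fixes J :: "'a::metric_space set"
  assumes fine: "\<And>e. e > 0 \<Longrightarrow> fine_cover e J"
  shows "locally path_connected J"
  unfolding locally_path_connected_im_kleinen
proof (intro allI impI)
  fix V x assume Vx: "openin (top_of_set J) V \<and> x \<in> V"
  then obtain e where "e > 0" and e: "\<And>y. y \<in> J \<Longrightarrow> dist y x < e \<Longrightarrow> y \<in> V"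
    and xJ: "x \<in> J" unfolding openin_euclidean_subtopology_iff by blast
  from fine[of "e/2"] obtain \<C> where fin: "finite \<C>" and un: "\<Union>\<C> = J"
    and \<C>: "\<And>C. C \<in> \<C> \<Longrightarrow> compact C \<and> path_connected C \<and> (\<forall>x\<in>C. \<forall>y\<in>C. dist x y \<le> e/2)"
    using \<open>e > 0\<close> unfolding fine_cover_def by fastforce
  have CV: "C \<subseteq> V" if "C \<in> \<C>" "x \<in> C" for C
  proof
    fix y assume "y \<in> C"
    then have "y \<in> J" "dist y x \<le> e/2" using \<C> that un by auto
    then show "y \<in> V" using e \<open>e > 0\<close> by simp
  qed
  \<comment> \<open>Every point of \<open>?U\<close> shares a piece with \<open>x\<close>.\<close>
  let ?U = "J \<inter> - \<Union>{C\<in>\<C>. x \<notin> C}"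
  have U: "\<exists>C\<in>\<C>. x \<in> C \<and> y \<in> C" if "y \<in> ?U" for y using that un by blast
  have "closed (\<Union>{C\<in>\<C>. x \<notin> C})" using fin \<C> by (intro closed_Union) (auto intro: compact_imp_closed)
  then have "openin (top_of_set J) ?U" by (intro openin_open_Int) (simp add: open_closed)
  moreover have "x \<in> ?U" using xJ by blast
  moreover have "?U \<subseteq> V" using U CV by blast
  moreover have "\<exists>p. path p \<and> path_image p \<subseteq> V \<and> pathstart p = x \<and> pathfinish p = y"
    if "y \<in> ?U" for y
    using U[OF that] CV \<C> unfolding path_connected_def by (meson order_trans)
  ultimately show "\<exists>U. openin (top_of_set J) U \<and> x \<in> U \<and> U \<subseteq> V \<and>
      (\<forall>y. y \<in> U \<longrightarrow> (\<exists>p. path p \<and> path_image p \<subseteq> V \<and> pathstart p = x \<and> pathfinish p = y))"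
    by (intro exI[of _ ?U]) blast
qed

lemma path_connected_component:
  assumes "locally path_connected J" "C \<in> components J"
  shows "path_connected C"
proof -
  obtain x where "x \<in> J" "C = connected_component_set J x"
    using assms(2) by (auto simp: components_def)
  then show ?thesis
    using path_component_eq_connected_component_set[OF assms(1), of x]
      path_connected_path_component[of J x] by simp
qed

context contracting_system
begin

lemma fine_cover_L_step:
  assumes "fine_cover e (L (Suc k))"
  shows "fine_cover (c * e) (L k)"
proof -
  from assms obtain \<C> where fin: "finite \<C>" and un: "\<Union>\<C> = L (Suc k)"
    and \<C>: "\<And>C. C \<in> \<C> \<Longrightarrow> compact C \<and> path_connected C \<and> (\<forall>x\<in>C. \<forall>y\<in>C. dist x y \<le> e)"
    unfolding fine_cover_def by fastforce
  let ?\<D> = "(\<lambda>(i, C). f (Suc k) i ` C) ` (I (Suc k) \<times> \<C>)"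
  have CX: "C \<subseteq> X" if "C \<in> \<C>" for C using Union_upper[OF that] L_subset_X unfolding un by (rule order_trans)
  have "finite ?\<D>" using fin finite_I[of "Suc k"] by simp
  moreover have "\<Union>?\<D> = L k" unfolding L_Suc[of k] un[symmetric] by auto
  moreover have "compact D \<and> path_connected D \<and> (\<forall>x\<in>D. \<forall>y\<in>D. dist x y \<le> c * e)"
    if "D \<in> ?\<D>" for D
  proof -
    obtain i C where i: "i \<in> I (Suc k)" and C: "C \<in> \<C>" and D: "D = f (Suc k) i ` C"
      using \<open>D \<in> ?\<D>\<close> by auto
    have cont: "continuous_on C (f (Suc k) i)"
      using continuous_on_subset[OF continuous_f CX[OF C]] i by simp
    have "dist (f (Suc k) i x) (f (Suc k) i y) \<le> c * e" if "x \<in> C" "y \<in> C" for x y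
    proof -
      have "dist (f (Suc k) i x) (f (Suc k) i y) \<le> c * dist x y"
        using lipschitz_onD[OF lipschitz_f[of "Suc k" i]] i that CX[OF C] by auto
      also have "\<dots> \<le> c * e" using \<C>[OF C] that c_nonneg by (simp add: mult_left_mono)
      finally show ?thesis .
    qed
    moreover have "compact D" "path_connected D" unfolding D
      using compact_continuous_image[OF cont] path_connected_continuous_image[OF cont] \<C>[OF C]
      by simp_all
    ultimately show ?thesis unfolding D by simp
  qed
  ultimately show ?thesis unfolding fine_cover_def by (intro exI[of _ ?\<D>]) simp
qed

lemma locally_path_connected_L_0:
  assumes "\<And>k. k \<ge> 1 \<Longrightarrow> path_connected (L k)"
  shows "locally path_connected (L 0)"
proof (rule locally_path_connected_if_fine_cover)
  have pos: "fine_cover (c ^ n * diameter X) (L k)" if "k \<ge> 1" for n k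
    using that
  proof (induction n arbitrary: k)
    case 0
    then show ?case unfolding fine_cover_def
      using compact_L assms dist_X L_subset_X[THEN subsetD] by (intro exI[of _ "{L k}"]) auto
  next
    case (Suc n)
    then show ?case using fine_cover_L_step[of "c ^ n * diameter X" k] by (simp add: mult.assoc)
  qed
  \<comment> \<open>\<open>L 0\<close> itself need not be connected, so it has to be split at least once.\<close>
  have fine: "fine_cover (c ^ Suc n * diameter X) (L 0)" for n
    using fine_cover_L_step[OF pos, of 0 n] by (simp add: mult.assoc)
  fix e :: real assume "e > 0"
  then have "\<forall>\<^sub>F n in sequentially. c ^ n * diameter X < e"
    using order_tendstoD(2)[OF power_c_tendsto] by blast
  then obtain n where "c ^ Suc n * diameter X < e"
    unfolding eventually_sequentially by (meson le_Suc_eq le_refl)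
  then show "fine_cover e (L 0)"
    using fine[of n] unfolding fine_cover_def by (meson less_imp_le order_trans)
qed

end

theorem theorem5:
  fixes X :: "'a::metric_space set"
    and I :: "nat \<Rightarrow> 'i set"
    and f :: "nat \<Rightarrow> 'i \<Rightarrow> 'a \<Rightarrow> 'a"
  assumes "compact X" and "X \<noteq> {}"
    and "nonautonomous_ifs X I f"
    and "\<And>k. k > 0 \<Longrightarrow> nerve_connected X I f k (k + 1)"
  shows "locally connected (limit_set X I f) \<and>
         (\<forall>C \<in> components (limit_set X I f). path_connected C) \<and>
         (nerve_connected X I f 0 1 \<longrightarrow>
            connected (limit_set X I f) \<and> path_connected (limit_set X I f))"
proof -
  obtain c where "c < 1" and c: "\<And>j i. j \<ge> 1 \<Longrightarrow> i \<in> I j \<Longrightarrow> c-lipschitz_on X (f j i)"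
    using assms(3) unfolding nonautonomous_ifs_def by blast
  interpret contracting_system X I f "max c 0"
  proof
    show "(max c 0)-lipschitz_on X (f j i)" if "j \<ge> 1" "i \<in> I j" for j i
      using c[OF that] by (rule lipschitz_on_le) simp
    show "f j i x \<in> X" if "j \<ge> 1" "i \<in> I j" "x \<in> X" for j i x
      using assms(3) that unfolding nonautonomous_ifs_def by blast
  qed (use assms \<open>c < 1\<close> in \<open>auto simp: nonautonomous_ifs_def\<close>)
  have lpc: "locally path_connected (limit_set X I f)"
    using locally_path_connected_L_0 path_connected_L assms(4) unfolding L_0 by auto
  have "path_connected (limit_set X I f)" if "nerve_connected X I f 0 1"
  proof -
    have "nerve_connected X I f j (j + 1)" for j using assms(4)[of j] that by (cases j) auto
    then show ?thesis using path_connected_L[of 0] unfolding L_0 by blast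
  qed
  then show ?thesis
    using lpc locally_path_connected_imp_locally_connected path_connected_component
      path_connected_imp_connected by blast
qed

end
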